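(* Let $\mathcal{H}$ be a real Hilbert space, let $C_i\subseteq\mathcal{H}$, $i\in I:=\{1,\ldots,M\}$, be closed and convex, and assume $C:=\bigcap_{i\in I}C_i\neq\emptyset$. Let the sequence $\{x^k\}_{k=0}^\infty$ be defined by the dynamic string averaging projection method, that is, $x^0\in\mathcal{H}$ and, for every $k=0,1,2,\ldots$, $x^{k+1}:=T_kx^k$, where $$T_k:=\sum_{n=1}^{N_k}\omega_n^k\prod_{j\in J_n^k}P_{C_j},$$ $J_n^k\subseteq I$ is a string and $\omega_n^k\in(0,1)$, $\sum_{n=1}^{N_k}\omega_n^k=1$. Let $I_k:=J_1^k\cup\ldots\cup J_{N_k}^k$. Assume that $\omega_n^k\geq\omega$ (for all $k$ and $n$) for some $\omega>0$ and that $m:=\sup_k\max_{1\leq n\leq N_k}|J_n^k|<\infty$. Moreover, assume that there is an integer $s\geq1$ such that for each $k=0,1,2,\ldots$ we have $I=I_k\cup\ldots\cup I_{k+s-1}$. Put $r:=d(x^0,C)$. Then the following statements hold true: (i) $\{x^k\}_{k=0}^\infty$ converges weakly to some point $x^\infty\in C\cap B(P_Cx^0,r)$. (ii) If the family $\{C_i\mid i\in I\}$ is regular over $B(P_Cx^0,r)$, then the convergence is in norm. (iii) If the family $\{C_i\mid i\in I\}$ is $\kappa_r$-linearly regular over $B(P_Cx^0,r)$, then the convergence is linear, that is, $\|x^k-x^\infty\|\leq c_rq_r^k$ for each $k=0,1,2,\ldots$, where $$c_r:=\frac{2d(x^0,C)}{q_r^{s-1}}\quad\text{and}\quad q_r:=\left(1-\frac{\omega}{2ms\kappa_r^2}\right)^{1/(2s)}.$$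 Moreover, for each $k=0,1,2,\ldots$ we have the error bound $$\frac{1}{2\kappa_r}\|x^k-x^\infty\|\leq\max_{i\in I}d(x^k,C_i)\leq c_rq_r^k.$$
   Context: $P_D$ denotes the metric projection onto a nonempty closed convex set $D\subseteq\mathcal{H}$, $d(x,D)=\inf\{\|x-z\|\mid z\in D\}$, and $B(x,r)$ is the closed ball with center $x$ and radius $r$. A string is a finite ordered subset $J=(j_1,\ldots,j_l)$ of $I$, of length $|J|=l$, and $\prod_{j\in J}P_{C_j}:=P_{C_{j_l}}\cdots P_{C_{j_1}}$ (composition, $P_{C_{j_1}}$ applied first). For $S\subseteq\mathcal{H}$, the family $\{C_1,\ldots,C_M\}$ of closed convex sets with nonempty intersection $C$ is called: - regular over $S$ if for every sequence $\{y^k\}\subseteq S$, $\max_{i}d(y^k,C_i)\to0$ implies $d(y^k,C)\to0$; - $\kappa_S$-linearly regular over $S$ if $d(x,C)\leq\kappa_S\max_{i}d(x,C_i)$ for all $x\in S$, where $\kappa_S>0$ is a constant; by convention such a constant is taken to satisfy $\kappa_S\geq1$. *)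

theory Defs
  imports "HOL-Analysis.Analysis"
begin

(* The library's closest_point is restricted to class heine_borel, i.e. to finite-dimensional
   inner product spaces. *)
definition metric_proj :: "'a::real_inner set \<Rightarrow> 'a \<Rightarrow> 'a" where
  "metric_proj D x = (THE z. z \<in> D \<and> (\<forall>y\<in>D. dist x z \<le> dist x y))"

definition weakly_converges_to :: "(nat \<Rightarrow> 'a::real_normed_vector) \<Rightarrow> 'a \<Rightarrow> bool" where
  "weakly_converges_to x l \<longleftrightarrow>
     (\<forall>f :: 'a \<Rightarrow> real. bounded_linear f \<longrightarrow> (\<lambda>k. f (x k)) \<longlonglongrightarrow> f l)"

(* Strings are lists of indices, whose first entry is applied first. *)
definition string_proj :: "('i \<Rightarrow> 'a::real_inner set) \<Rightarrow> 'i list \<Rightarrow> 'a \<Rightarrow> 'a" where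
  "string_proj C J x = fold (\<lambda>j. metric_proj (C j)) J x"

definition string_averaging ::
  "('i \<Rightarrow> 'a::real_inner set) \<Rightarrow> nat \<Rightarrow> (nat \<Rightarrow> real) \<Rightarrow> (nat \<Rightarrow> 'i list) \<Rightarrow> 'a \<Rightarrow> 'a" where
  "string_averaging C N w J x = (\<Sum>n=1..N. w n *\<^sub>R string_proj C (J n) x)"

definition regular_over :: "'i set \<Rightarrow> ('i \<Rightarrow> 'a::real_normed_vector set) \<Rightarrow> 'a set \<Rightarrow> bool" where
  "regular_over I C S \<longleftrightarrow>
     (\<forall>y :: nat \<Rightarrow> 'a. (\<forall>k. y k \<in> S) \<longrightarrow> (\<lambda>k. MAX i\<in>I. infdist (y k) (C i)) \<longlonglongrightarrow> 0 \<longrightarrow>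
        (\<lambda>k. infdist (y k) (\<Inter>i\<in>I. C i)) \<longlonglongrightarrow> 0)"

(* The constant is normalised to be at least 1. *)
definition linearly_regular_over ::
  "real \<Rightarrow> 'i set \<Rightarrow> ('i \<Rightarrow> 'a::real_normed_vector set) \<Rightarrow> 'a set \<Rightarrow> bool" where
  "linearly_regular_over \<kappa> I C S \<longleftrightarrow>
     1 \<le> \<kappa> \<and> (\<forall>x\<in>S. infdist x (\<Inter>i\<in>I. C i) \<le> \<kappa> * (MAX i\<in>I. infdist x (C i)))"

end

theory Submission
  imports Defs
begin

text \<open>
  Let \<open>z\<close> be a common point of the sets. A single projection lowers the squared distance to \<open>z\<close> by at
  least the square of its displacement. By the Cauchy-Schwarz inequality and the convexity of the
  squared norm, this adds up along strings (\<open>string_proj_decrease\<close>), over the weighted average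
  (\<open>string_averaging_decrease\<close>), and over \<open>s\<close> consecutive steps (\<open>infdist_window_le\<close>), where every
  set is visited. The outcome is, for every \<open>i \<in> I\<close>,
  \<open>d(x k, C i)\<^sup>2 \<le> (m s / \<omega>) (\<parallel>x k - z\<parallel>\<^sup>2 - \<parallel>x (k + s) - z\<parallel>\<^sup>2)\<close>.

  In particular the sequence is Fejer monotone with respect to \<open>D\<close>, and its distance to each \<open>C i\<close>
  tends to 0. This forces weak convergence to some point of \<open>D\<close>
  (\<open>fejer_monotone_weakly_convergent\<close>). Balls are weakly closed, so the limit
  is within \<open>2 d(x k, D)\<close> of \<open>x k\<close> for every \<open>k\<close> (\<open>fejer_monotone_weak_limit\<close>). Under regularity
  \<open>d(x k, D)\<close> tends to 0. Under linear regularity, the estimate above with \<open>z\<close> the projection of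
  \<open>x k\<close> onto \<open>D\<close> makes \<open>d(x k, D)\<^sup>2\<close> shrink by the factor \<open>1 - \<omega> / (m s \<kappa>\<^sup>2)\<close> over every
  \<open>s\<close> steps, which is better than the required factor \<open>q ^ (2 s)\<close>.
\<close>

section \<open>Projections and nested convex sets in Hilbert space\<close>

text \<open>A substitute for weak compactness: nested convex sets have a common point as long as they stay at
  bounded distance from some point \<open>a\<close>. Near-minimisers of the distance from \<open>a\<close> to the sets \<open>K n\<close>
  form a Cauchy sequence, by the parallelogram identity. For a constant sequence of sets, the lemma
  gives the existence of nearest points.\<close>

lemma nested_convex_sets_nearest_point:
  fixes K :: "nat \<Rightarrow> 'a::{real_inner, complete_space} set"
  assumes closed: "\<And>n. closed (K n)" and conv: "\<And>n. convex (K n)" and ne: "\<And>n. K n \<noteq> {}"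
    and dec: "decseq K" and bdd: "\<And>n. infdist a (K n) \<le> R"
  obtains p where "p \<in> (\<Inter>n. K n)" "(\<lambda>n. infdist a (K n)) \<longlonglongrightarrow> dist a p"
proof -
  define d where "d n = infdist a (K n)" for n
  have d_nonneg: "0 \<le> d n" for n by (simp add: d_def infdist_nonneg)
  have inc: "incseq d"
    unfolding d_def by (intro monoI infdist_mono decseqD[OF dec] ne)
  obtain L where L: "d \<longlonglongrightarrow> L" and d_le: "\<And>n. d n \<le> L"
    using incseq_convergent[OF inc, of R] bdd by (auto simp: d_def)
  have "\<exists>p\<in>K n. dist a p < d n + inverse (real (Suc n))" for n
  proof -
    have "(INF p\<in>K n. dist a p) < d n + inverse (real (Suc n))"
      unfolding d_def infdist_notempty[OF ne[of n], symmetric] by simp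
    then show ?thesis
      by (subst (asm) cINF_less_iff) (auto simp: ne intro: bdd_belowI2[of _ 0])
  qed
  then obtain p where p: "\<And>n. p n \<in> K n"
    and p_dist: "\<And>n. dist a (p n) < d n + inverse (real (Suc n))" by metis
  have p_in: "p m \<in> K n" if "n \<le> m" for m n
    using p[of m] decseqD[OF dec that] by auto
  \<comment> \<open>This bounds the squared distance between \<open>p n\<close> and all later \<open>p m\<close>: their midpoint lies in
    \<open>K n\<close>, hence at distance at least \<open>d n\<close> from \<open>a\<close>.\<close>
  define e where "e n = 4 * (L + inverse (real (Suc n)))\<^sup>2 - 4 * (d n)\<^sup>2" for n
  have "e \<longlonglongrightarrow> 4 * (L + 0)\<^sup>2 - 4 * L\<^sup>2"
    unfolding e_def by (intro tendsto_intros L LIMSEQ_inverse_real_of_nat)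
  then have e_lim: "e \<longlonglongrightarrow> 0" by simp
  have close: "(dist (p n) (p m))\<^sup>2 \<le> e n" if nm: "n \<le> m" for n m
  proof -
    have "(1/2) *\<^sub>R p n + (1/2) *\<^sub>R p m \<in> K n"
      by (intro convexD[OF conv] p p_in nm) auto
    then have "d n \<le> dist a ((1/2) *\<^sub>R p n + (1/2) *\<^sub>R p m)"
      unfolding d_def by (rule infdist_le)
    then have mid: "(d n)\<^sup>2 \<le> (norm (a - ((1/2) *\<^sub>R p n + (1/2) *\<^sub>R p m)))\<^sup>2"
      using d_nonneg by (simp add: dist_norm power_mono)
    have "(dist (p n) (p m))\<^sup>2 = 2 * (norm (a - p n))\<^sup>2 + 2 * (norm (a - p m))\<^sup>2
        - 4 * (norm (a - ((1/2) *\<^sub>R p n + (1/2) *\<^sub>R p m)))\<^sup>2"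
      unfolding dist_norm power2_norm_eq_inner by (simp add: algebra_simps inner_commute)
    moreover have "(norm (a - p n))\<^sup>2 \<le> (L + inverse (real (Suc n)))\<^sup>2"
      using p_dist[of n] d_le[of n] by (intro power_mono) (auto simp: dist_norm)
    moreover have "inverse (real (Suc m)) \<le> inverse (real (Suc n))"
      using nm by (intro le_imp_inverse_le) auto
    then have "norm (a - p m) \<le> L + inverse (real (Suc n))"
      using p_dist[of m] d_le[of m] unfolding dist_norm by linarith
    then have "(norm (a - p m))\<^sup>2 \<le> (L + inverse (real (Suc n)))\<^sup>2"
      by (rule power_mono) simp
    ultimately show ?thesis using mid by (simp add: e_def)
  qed
  have "Cauchy p"
    unfolding Cauchy_altdef
  proof (intro allI impI)
    fix \<epsilon> :: real assume "\<epsilon> > 0"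
    then have "\<forall>\<^sub>F n in sequentially. e n < \<epsilon>\<^sup>2"
      by (intro order_tendstoD(2)[OF e_lim]) simp
    then obtain n0 where "\<And>n. n \<ge> n0 \<Longrightarrow> e n < \<epsilon>\<^sup>2"
      by (auto simp: eventually_sequentially)
    then have "\<forall>n\<ge>n0. \<forall>m>n. dist (p n) (p m) < \<epsilon>"
      using close \<open>\<epsilon> > 0\<close> by (meson less_imp_le order.strict_trans1 power2_less_imp_less)
    then show "\<exists>n0. \<forall>n\<ge>n0. \<forall>m>n. dist (p n) (p m) < \<epsilon>" ..
  qed
  then obtain q where q: "p \<longlonglongrightarrow> q"
    using Cauchy_convergent convergent_def by blast
  have q_in: "q \<in> K n" for n
    by (rule Lim_in_closed_set[OF closed _ _ q]) (auto simp: eventually_sequentially intro: p_in)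
  have "(\<lambda>n. dist a (p n)) \<longlonglongrightarrow> L"
  proof (rule tendsto_sandwich)
    show "\<forall>\<^sub>F n in sequentially. d n \<le> dist a (p n)"
      unfolding d_def by (intro always_eventually allI infdist_le p)
    show "\<forall>\<^sub>F n in sequentially. dist a (p n) \<le> d n + inverse (real (Suc n))"
      by (intro always_eventually allI less_imp_le p_dist)
    show "(\<lambda>n. d n + inverse (real (Suc n))) \<longlonglongrightarrow> L"
      using tendsto_add[OF L LIMSEQ_inverse_real_of_nat] by simp
  qed (rule L)
  moreover have "(\<lambda>n. dist a (p n)) \<longlonglongrightarrow> dist a q"
    by (intro tendsto_intros q)
  ultimately have "L = dist a q" by (rule LIMSEQ_unique)
  with L q_in that show thesis by (auto simp: d_def[abs_def])
qed

lemma metric_proj_closed_convex: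
  fixes D :: "'a::{real_inner, complete_space} set"
  assumes "closed D" "convex D" "D \<noteq> {}"
  shows metric_proj_in: "metric_proj D a \<in> D"
    and dist_metric_proj: "dist a (metric_proj D a) = infdist a D"
proof -
  obtain p where p: "p \<in> D" "infdist a D = dist a p"
    using nested_convex_sets_nearest_point[of "\<lambda>_. D" a "infdist a D"] assms
    by (auto simp: decseq_def LIMSEQ_const_iff)
  then have min: "\<forall>y\<in>D. dist a p \<le> dist a y"
    using infdist_le by metis
  have "metric_proj D a = p"
    unfolding metric_proj_def
    using p min any_closest_point_unique[OF assms(2,1)] by (intro the_equality) auto
  with p show "metric_proj D a \<in> D" "dist a (metric_proj D a) = infdist a D" by auto
qed

text \<open>This holds because the angle at the projection between \<open>a\<close> and any point \<open>z\<close> of \<open>D\<close> is not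
  acute.\<close>

lemma metric_proj_decrease:
  fixes D :: "'a::{real_inner, complete_space} set"
  assumes "closed D" "convex D" "z \<in> D"
  shows "(dist a (metric_proj D a))\<^sup>2 \<le> (norm (a - z))\<^sup>2 - (norm (metric_proj D a - z))\<^sup>2"
proof -
  let ?p = "metric_proj D a"
  have ne: "D \<noteq> {}" using assms by auto
  have "\<forall>y\<in>D. dist a ?p \<le> dist a y"
    using dist_metric_proj[OF assms(1,2) ne] by (auto intro: infdist_le)
  then have "inner (a - ?p) (z - ?p) \<le> 0"
    using any_closest_point_dot[OF assms(2,1) metric_proj_in[OF assms(1,2) ne] assms(3)] by blast
  then show ?thesis
    unfolding dist_norm power2_norm_eq_inner by (simp add: algebra_simps inner_commute)
qed

lemma convex_infdist_sublevel:
  fixes S :: "'a::{real_inner, complete_space} set"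
  assumes "closed S" "convex S" "S \<noteq> {}"
  shows "convex {y. infdist y S \<le> e}"
proof (rule convexI)
  fix y y' :: 'a and u v :: real
  assume y: "y \<in> {y. infdist y S \<le> e}" "y' \<in> {y. infdist y S \<le> e}" and uv: "0 \<le> u" "0 \<le> v" "u + v = 1"
  let ?p = "metric_proj S y" and ?p' = "metric_proj S y'"
  have "u *\<^sub>R ?p + v *\<^sub>R ?p' \<in> S"
    using uv by (intro convexD[OF assms(2)] metric_proj_in assms)
  then have "infdist (u *\<^sub>R y + v *\<^sub>R y') S \<le> norm ((u *\<^sub>R y + v *\<^sub>R y') - (u *\<^sub>R ?p + v *\<^sub>R ?p'))"
    by (metis dist_norm infdist_le)
  also have "\<dots> = norm (u *\<^sub>R (y - ?p) + v *\<^sub>R (y' - ?p'))"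
    by (simp add: algebra_simps)
  also have "\<dots> \<le> u * norm (y - ?p) + v * norm (y' - ?p')"
    using norm_triangle_ineq[of "u *\<^sub>R (y - ?p)" "v *\<^sub>R (y' - ?p')"] uv by simp
  also have "\<dots> = u * infdist y S + v * infdist y' S"
    using dist_metric_proj[OF assms] by (simp add: dist_norm)
  also have "\<dots> \<le> e"
    using y uv by (intro convex_bound_le) auto
  finally show "u *\<^sub>R y + v *\<^sub>R y' \<in> {y. infdist y S \<le> e}" by simp
qed

section \<open>Weak convergence of Fejer monotone sequences\<close>

text \<open>The distance from \<open>x k\<close> to each point of \<open>D\<close> is nonincreasing in \<open>k\<close>.\<close>

definition fejer_monotone :: "'a::real_normed_vector set \<Rightarrow> (nat \<Rightarrow> 'a) \<Rightarrow> bool" where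
  "fejer_monotone D x \<longleftrightarrow> (\<forall>z\<in>D. decseq (\<lambda>k. norm (x k - z)))"

lemma fejer_monotone_norm_convergent:
  assumes "fejer_monotone D x" "z \<in> D"
  obtains L where "(\<lambda>k. norm (x k - z)) \<longlonglongrightarrow> L"
proof -
  have "decseq (\<lambda>k. norm (x k - z))" using assms by (simp add: fejer_monotone_def)
  then show thesis using decseq_convergent[of "\<lambda>k. norm (x k - z)" 0] that by auto
qed

lemma fejer_monotone_bounded:
  assumes "fejer_monotone D x" "D \<noteq> {}"
  shows "bounded (range x)"
proof -
  obtain z where "z \<in> D" using assms(2) by auto
  then have "dist z (x k) \<le> norm (x 0 - z)" for k
    using assms(1) decseqD[of "\<lambda>k. norm (x k - z)" 0 k]
    by (auto simp: fejer_monotone_def dist_norm norm_minus_commute)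
  then show ?thesis by (auto simp: bounded_def)
qed

text \<open>The closed convex hulls of the tails of \<open>x\<close>, taken along an infinite set \<open>A\<close> of indices, are
  nested and bounded. Their common points take the place of the weak cluster points along \<open>A\<close>. Such a
  point exists, belongs to every \<open>C i\<close> because the sublevel sets of \<open>infdist\<close> are convex, and is unique
  by Opial's argument: for \<open>l\<close> and \<open>l'\<close> in all \<open>C i\<close>, the difference
  \<open>\<parallel>x k - l'\<parallel>\<^sup>2 - \<parallel>x k - l\<parallel>\<^sup>2\<close> converges and is an affine function of \<open>x k\<close>. If a functional \<open>f\<close>
  exceeded \<open>f l + e\<close> along infinitely many indices, a common point along these would
  differ from \<open>l\<close>.\<close>

theorem fejer_monotone_weakly_convergent:
  fixes C :: "'i \<Rightarrow> 'a::{real_inner, complete_space} set"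
  assumes C: "\<And>i. i \<in> I \<Longrightarrow> closed (C i) \<and> convex (C i)" and ne: "(\<Inter>i\<in>I. C i) \<noteq> {}"
    and fejer: "fejer_monotone (\<Inter>i\<in>I. C i) x"
    and dist0: "\<And>i. i \<in> I \<Longrightarrow> (\<lambda>k. infdist (x k) (C i)) \<longlonglongrightarrow> 0"
  obtains l where "l \<in> (\<Inter>i\<in>I. C i)" "weakly_converges_to x l"
proof -
  \<comment> \<open>The hull of the tail from \<open>n\<close> on along the indices in \<open>A\<close>.\<close>
  define H where "H A n = closure (convex hull (x ` (A \<inter> {n..})))" for A :: "nat set" and n
  have H_sub: "H A n \<subseteq> T" if "\<And>k. k \<ge> n \<Longrightarrow> k \<in> A \<Longrightarrow> x k \<in> T" "closed T" "convex T" for A n T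
    unfolding H_def using that by (intro closure_minimal hull_minimal) auto
  have nonempty: "\<exists>l. l \<in> (\<Inter>n. H A n)" if A: "infinite A" for A
  proof -
    obtain R where R: "\<And>k. norm (x k) \<le> R"
      using fejer_monotone_bounded[OF fejer ne] by (auto simp: bounded_iff)
    have ne': "\<exists>k\<in>A. k \<ge> n" for n
      using A infinite_nat_iff_unbounded_le by auto
    have x_in: "x k \<in> H A n" if "k \<in> A" "k \<ge> n" for k n
      using that by (auto simp: H_def intro!: closure_subset[THEN subsetD] hull_inc)
    obtain l where "l \<in> (\<Inter>n. H A n)"
    proof (rule nested_convex_sets_nearest_point[of "H A" 0 R])
      show "decseq (H A)"
        unfolding H_def by (intro decseq_SucI closure_mono hull_mono) auto
      show "infdist 0 (H A n) \<le> R" for n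
        using ne'[of n] x_in R infdist_le2[of _ "H A n" 0 R] by auto
      show "H A n \<noteq> {}" for n using ne'[of n] x_in by auto
    qed (auto simp: H_def)
    then show ?thesis by blast
  qed
  have in_C: "l \<in> (\<Inter>i\<in>I. C i)" if l: "l \<in> (\<Inter>n. H A n)" for l A
  proof
    fix i assume i: "i \<in> I"
    then have Ci: "closed (C i)" "convex (C i)" "C i \<noteq> {}"
      using C[OF i] ne by auto
    have "infdist l (C i) \<le> 0 + e" if "e > 0" for e
    proof -
      have "\<forall>\<^sub>F k in sequentially. infdist (x k) (C i) < e"
        by (rule order_tendstoD(2)[OF dist0[OF i] that])
      then obtain n where "\<And>k. k \<ge> n \<Longrightarrow> infdist (x k) (C i) \<le> e"
        by (auto simp: eventually_sequentially intro: less_imp_le)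
      then have "H A n \<subseteq> {y. infdist y (C i) \<le> e}"
        using Ci by (intro H_sub convex_infdist_sublevel)
          (auto intro!: closed_Collect_le continuous_intros)
      with l show ?thesis by auto
    qed
    then have "infdist l (C i) \<le> 0" by (rule field_le_epsilon)
    then show "l \<in> C i"
      using in_closed_iff_infdist_zero[OF Ci(1,3), of l] infdist_nonneg[of l "C i"] by simp
  qed
  obtain l where l: "l \<in> (\<Inter>n. H UNIV n)" using nonempty[of UNIV] by auto
  have unique: "l' = l" if l': "l' \<in> (\<Inter>n. H A n)" for l' A
  proof -
    have mem: "l \<in> (\<Inter>i\<in>I. C i)" "l' \<in> (\<Inter>i\<in>I. C i)"
      using in_C l l' by blast+
    obtain a b where a: "(\<lambda>k. norm (x k - l)) \<longlonglongrightarrow> a" and b: "(\<lambda>k. norm (x k - l')) \<longlonglongrightarrow> b"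
      using fejer_monotone_norm_convergent[OF fejer] mem by metis
    \<comment> \<open>\<open>g\<close> converges along \<open>x\<close>, so it is constant on the common points of the hulls.\<close>
    define g where "g y = inner (l - l') y" for y
    have g_eq: "g (x k) = ((norm (x k - l'))\<^sup>2 - (norm (x k - l))\<^sup>2 + inner l l - inner l' l') / 2" for k
      unfolding g_def power2_norm_eq_inner by (simp add: algebra_simps inner_commute)
    define c where "c = (b\<^sup>2 - a\<^sup>2 + inner l l - inner l' l') / 2"
    have g_lim: "(\<lambda>k. g (x k)) \<longlonglongrightarrow> c"
      unfolding g_eq c_def by (intro tendsto_intros a b) auto
    have g_cluster: "g y = c" if y: "y \<in> (\<Inter>n. H B n)" for y B
    proof -
      have "\<bar>g y - c\<bar> \<le> 0 + e" if "e > 0" for e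
      proof -
        have "\<forall>\<^sub>F k in sequentially. dist (g (x k)) c < e"
          using tendstoD[OF g_lim that] .
        then obtain n where "\<And>k. k \<ge> n \<Longrightarrow> \<bar>g (x k) - c\<bar> \<le> e"
          by (auto simp: eventually_sequentially dist_real_def intro: less_imp_le)
        then have "H B n \<subseteq> {y. inner (l - l') y \<le> c + e} \<inter> {y. inner (l - l') y \<ge> c - e}"
          by (intro H_sub closed_Int convex_Int closed_halfspace_le closed_halfspace_ge
              convex_halfspace_le convex_halfspace_ge) (fastforce simp: g_def abs_le_iff)
        with y show ?thesis by (auto simp: g_def abs_le_iff)
      qed
      then have "\<bar>g y - c\<bar> \<le> 0" by (rule field_le_epsilon)
      then show ?thesis by simp
    qed
    have "g l = g l'" using g_cluster[OF l] g_cluster[OF l'] by simp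
    then have "inner (l - l') (l - l') = 0" by (simp add: g_def inner_diff_right)
    then show ?thesis by simp
  qed
  have upper: "\<forall>\<^sub>F k in sequentially. f (x k) < f l + e"
    if f: "bounded_linear f" and e: "e > 0" for f :: "'a \<Rightarrow> real" and e
  proof (rule ccontr)
    interpret bounded_linear f by (rule f)
    let ?A = "{k. f l + e \<le> f (x k)}"
    assume "\<not> ?thesis"
    then have "infinite ?A"
      by (simp add: not_eventually not_less frequently_cofinite flip: cofinite_eq_sequentially)
    then obtain l' where l': "l' \<in> (\<Inter>n. H ?A n)" using nonempty by blast
    have "H ?A 0 \<subseteq> {y. f l + e \<le> f y}"
    proof (rule H_sub)
      show "closed {y. f l + e \<le> f y}"
        by (intro closed_Collect_le continuous_intros linear_continuous_on f)
      show "convex {y. f l + e \<le> f y}"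
        using convex_linear_vimage[OF linear_axioms, of "{f l + e..}"] by (simp add: vimage_def)
    qed auto
    with l' have "f l + e \<le> f l'" by auto
    with unique[OF l'] e show False by simp
  qed
  have "weakly_converges_to x l"
    unfolding weakly_converges_to_def
  proof (intro allI impI tendstoI)
    fix f :: "'a \<Rightarrow> real" and e :: real assume f: "bounded_linear f" and "e > 0"
    then have "\<forall>\<^sub>F k in sequentially. f (x k) < f l + e"
      "\<forall>\<^sub>F k in sequentially. - f (x k) < - f l + e"
      using upper[OF f] upper[OF bounded_linear_minus[OF f]] by auto
    then show "\<forall>\<^sub>F k in sequentially. dist (f (x k)) (f l) < e"
      by eventually_elim (auto simp: dist_real_def)
  qed
  with in_C[OF l] that show thesis by blast
qed

lemma weakly_converges_to_cball:
  fixes x :: "nat \<Rightarrow> 'a::real_inner"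
  assumes weak: "weakly_converges_to x l" and "\<forall>\<^sub>F k in sequentially. x k \<in> cball p R"
  shows "l \<in> cball p R"
proof -
  have "(\<lambda>k. inner (l - p) (x k)) \<longlonglongrightarrow> inner (l - p) l"
    using weak bounded_linear_inner_right unfolding weakly_converges_to_def by blast
  then have "(\<lambda>k. inner (l - p) (x k) - inner (l - p) p) \<longlonglongrightarrow> inner (l - p) l - inner (l - p) p"
    by (rule tendsto_diff) (rule tendsto_const)
  moreover have "\<forall>\<^sub>F k in sequentially. inner (l - p) (x k) - inner (l - p) p \<le> norm (l - p) * R"
    using assms(2)
  proof eventually_elim
    fix k assume "x k \<in> cball p R"
    then have "norm (l - p) * norm (x k - p) \<le> norm (l - p) * R"
      by (intro mult_left_mono) (auto simp: dist_norm norm_minus_commute)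
    then show "inner (l - p) (x k) - inner (l - p) p \<le> norm (l - p) * R"
      using norm_cauchy_schwarz[of "l - p" "x k - p"] by (simp add: inner_diff_right)
  qed
  ultimately have "inner (l - p) l - inner (l - p) p \<le> norm (l - p) * R"
    by (rule tendsto_upperbound) simp
  then have le: "norm (l - p) * norm (l - p) \<le> norm (l - p) * R"
    by (simp flip: inner_diff_right power2_norm_eq_inner power2_eq_square)
  have "R \<ge> 0"
    using eventually_happens'[OF _ assms(2)] by (auto intro: order_trans[OF zero_le_dist])
  with le have "norm (l - p) \<le> R" by (cases "l = p") auto
  then show ?thesis by (simp add: dist_norm norm_minus_commute)
qed

text \<open>From \<open>x k\<close> on, the sequence stays in the ball about the projection of \<open>x k\<close> with radius
  \<open>d(x k, D)\<close>, and this ball is weakly closed.\<close>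

lemma fejer_monotone_weak_limit:
  fixes D :: "'a::{real_inner, complete_space} set"
  assumes D: "closed D" "convex D" "D \<noteq> {}" and fejer: "fejer_monotone D x"
    and weak: "weakly_converges_to x l"
  shows "l \<in> cball (metric_proj D (x k)) (infdist (x k) D)"
    and "norm (x k - l) \<le> 2 * infdist (x k) D"
proof -
  let ?p = "metric_proj D (x k)"
  have "decseq (\<lambda>j. norm (x j - ?p))"
    using fejer metric_proj_in[OF D] by (auto simp: fejer_monotone_def)
  then have "norm (x j - ?p) \<le> norm (x k - ?p)" if "j \<ge> k" for j
    using that by (rule decseqD)
  then have "\<forall>\<^sub>F j in sequentially. x j \<in> cball ?p (infdist (x k) D)"
    using dist_metric_proj[OF D, of "x k"]
    by (auto simp: eventually_sequentially dist_norm norm_minus_commute)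
  then show l: "l \<in> cball ?p (infdist (x k) D)"
    by (rule weakly_converges_to_cball[OF weak])
  then show "norm (x k - l) \<le> 2 * infdist (x k) D"
    using dist_triangle[of "x k" l ?p] dist_metric_proj[OF D, of "x k"]
    by (simp add: dist_norm)
qed

section \<open>Decrease along strings, averages and windows\<close>

text \<open>The Cauchy-Schwarz inequality in the form used in the inductions below: it merges one
  displacement \<open>a\<close> with a displacement \<open>b\<close> accumulated over \<open>l\<close> steps.\<close>

lemma square_sum_le_Suc_mult:
  fixes a b A B :: real and l :: nat
  assumes "a\<^sup>2 \<le> A" "b\<^sup>2 \<le> real l * B" "0 \<le> B"
  shows "(a + b)\<^sup>2 \<le> real (Suc l) * (A + B)"
proof -
  have A: "0 \<le> A" using assms(1) zero_le_power2[of a] by linarith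
  have "(2 * a * b)\<^sup>2 = 4 * (a\<^sup>2 * b\<^sup>2)" by (simp add: power_mult_distrib)
  also have "\<dots> \<le> 4 * (A * (real l * B))"
    using assms A by (intro mult_left_mono mult_mono) auto
  also have "\<dots> \<le> (real l * A + B)\<^sup>2"
    using zero_le_power2[of "real l * A - B"] by (simp add: power2_eq_square algebra_simps)
  finally have "2 * a * b \<le> real l * A + B"
    by (rule power2_le_imp_le) (use A assms in auto)
  with assms show ?thesis by (simp add: power2_sum algebra_simps)
qed

text \<open>Two quantities are controlled by the decrease of the squared distance to the common point \<open>z\<close>:
  the total displacement, and the distance from the starting point to each set of the string.\<close>

lemma string_proj_decrease:
  fixes C :: "'i \<Rightarrow> 'a::{real_inner, complete_space} set"
  assumes "\<And>j. j \<in> set J \<Longrightarrow> closed (C j) \<and> convex (C j) \<and> z \<in> C j"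
  shows "norm (string_proj C J y - z) \<le> norm (y - z) \<and>
    (dist y (string_proj C J y))\<^sup>2
      \<le> real (length J) * ((norm (y - z))\<^sup>2 - (norm (string_proj C J y - z))\<^sup>2) \<and>
    (\<forall>j\<in>set J. (infdist y (C j))\<^sup>2
      \<le> real (length J) * ((norm (y - z))\<^sup>2 - (norm (string_proj C J y - z))\<^sup>2))"
  using assms
proof (induction J arbitrary: y)
  case Nil
  then show ?case by (simp add: string_proj_def)
next
  case (Cons i J)
  define y' where "y' = metric_proj (C i) y"
  define t where "t = string_proj C J y'"
  have t: "string_proj C (i # J) y = t" by (simp add: string_proj_def t_def y'_def)
  have Ci: "closed (C i)" "convex (C i)" "z \<in> C i" using Cons.prems by auto
  let ?A = "(norm (y - z))\<^sup>2 - (norm (y' - z))\<^sup>2" and ?B = "(norm (y' - z))\<^sup>2 - (norm (t - z))\<^sup>2"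
  have a: "(dist y y')\<^sup>2 \<le> ?A"
    unfolding y'_def by (rule metric_proj_decrease[OF Ci])
  have IH: "norm (t - z) \<le> norm (y' - z)" "(dist y' t)\<^sup>2 \<le> real (length J) * ?B"
    "\<And>j. j \<in> set J \<Longrightarrow> (infdist y' (C j))\<^sup>2 \<le> real (length J) * ?B"
    using Cons.IH[of y'] Cons.prems by (auto simp: t_def)
  have B: "0 \<le> ?B" using IH(1) by (simp add: power_mono)
  have merge: "u\<^sup>2 \<le> real (length (i # J)) * ((norm (y - z))\<^sup>2 - (norm (t - z))\<^sup>2)"
    if "0 \<le> u" "u \<le> dist y y' + b" "b\<^sup>2 \<le> real (length J) * ?B" for u b
  proof -
    have "u\<^sup>2 \<le> (dist y y' + b)\<^sup>2" using that by (intro power_mono)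
    also have "\<dots> \<le> real (Suc (length J)) * (?A + ?B)"
      by (rule square_sum_le_Suc_mult[OF a that(3) B])
    finally show ?thesis by simp
  qed
  have "norm (y' - z) \<le> norm (y - z)"
    by (rule power2_le_imp_le) (use a zero_le_power2[of "dist y y'"] in linarith, simp)
  with IH(1) have "norm (t - z) \<le> norm (y - z)" by simp
  moreover have "(dist y t)\<^sup>2 \<le> real (length (i # J)) * ((norm (y - z))\<^sup>2 - (norm (t - z))\<^sup>2)"
    by (rule merge[OF zero_le_dist dist_triangle IH(2)])
  moreover have "(infdist y (C j))\<^sup>2 \<le> real (length (i # J)) * ((norm (y - z))\<^sup>2 - (norm (t - z))\<^sup>2)"
    if "j \<in> set (i # J)" for j
  proof (cases "j = i")
    case True
    have "infdist y (C i) \<le> dist y y'"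
      unfolding y'_def using Ci by (intro infdist_le metric_proj_in) auto
    with True B show ?thesis
      by (intro merge[of _ 0]) (auto simp: infdist_nonneg)
  next
    case False
    with that IH(3) show ?thesis
      using infdist_triangle[of y "C j" y'] by (intro merge) (auto simp: infdist_nonneg)
  qed
  ultimately show ?case unfolding t by blast
qed

lemma norm_power2_convex_sum:
  fixes u :: "'i \<Rightarrow> 'a::real_inner"
  assumes "finite S" "\<And>i. i \<in> S \<Longrightarrow> 0 \<le> w i" "(\<Sum>i\<in>S. w i) = 1"
  shows "(norm (\<Sum>i\<in>S. w i *\<^sub>R u i))\<^sup>2 \<le> (\<Sum>i\<in>S. w i * (norm (u i))\<^sup>2)"
proof -
  have "S \<noteq> {}" using assms(3) by auto
  have "norm (\<Sum>i\<in>S. w i *\<^sub>R u i) \<le> (\<Sum>i\<in>S. w i *\<^sub>R norm (u i))"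
    using norm_sum[of "\<lambda>i. w i *\<^sub>R u i" S] assms(2) by simp
  then have "(norm (\<Sum>i\<in>S. w i *\<^sub>R u i))\<^sup>2 \<le> (\<Sum>i\<in>S. w i *\<^sub>R norm (u i))\<^sup>2"
    by (rule power_mono) simp
  also have "\<dots> \<le> (\<Sum>i\<in>S. w i * (norm (u i))\<^sup>2)"
    by (rule convex_on_sum[OF assms(1) \<open>S \<noteq> {}\<close> convex_power2 assms(3,2)]) auto
  finally show ?thesis .
qed

lemma string_averaging_decrease:
  fixes C :: "'i \<Rightarrow> 'a::{real_inner, complete_space} set" and y z :: 'a
  assumes C: "\<And>n j. n \<in> {1..N} \<Longrightarrow> j \<in> set (J n) \<Longrightarrow> closed (C j) \<and> convex (C j) \<and> z \<in> C j"
    and w: "\<And>n. n \<in> {1..N} \<Longrightarrow> \<omega> \<le> w n" "0 < \<omega>" "(\<Sum>n=1..N. w n) = 1"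
    and len: "\<And>n. n \<in> {1..N} \<Longrightarrow> length (J n) \<le> m"
  defines "t \<equiv> string_averaging C N w J y"
  shows "norm (t - z) \<le> norm (y - z)"
    and "(dist y t)\<^sup>2 \<le> real m * ((norm (y - z))\<^sup>2 - (norm (t - z))\<^sup>2)"
    and "n \<in> {1..N} \<Longrightarrow> j \<in> set (J n) \<Longrightarrow>
      (infdist y (C j))\<^sup>2 \<le> real m / \<omega> * ((norm (y - z))\<^sup>2 - (norm (t - z))\<^sup>2)"
proof -
  define S where "S n = string_proj C (J n) y" for n
  define A where "A n = (norm (y - z))\<^sup>2 - (norm (S n - z))\<^sup>2" for n
  let ?A = "(norm (y - z))\<^sup>2 - (norm (t - z))\<^sup>2"
  have t: "t = (\<Sum>n=1..N. w n *\<^sub>R S n)" by (simp add: t_def string_averaging_def S_def)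
  have w0: "0 \<le> w n" if "n \<in> {1..N}" for n using w(1)[OF that] w(2) by linarith
  have shift: "t - v = (\<Sum>n=1..N. w n *\<^sub>R (S n - v))" for v
    using w(3) by (simp add: t scaleR_diff_right sum_subtractf flip: scaleR_left.sum)
  have jensen: "(norm (t - v))\<^sup>2 \<le> (\<Sum>n=1..N. w n * (norm (S n - v))\<^sup>2)" for v
    unfolding shift by (rule norm_power2_convex_sum) (use w0 w(3) in auto)
  have A0: "0 \<le> A n" and step: "(norm (S n - y))\<^sup>2 \<le> real m * A n"
    and reach: "j \<in> set (J n) \<Longrightarrow> (infdist y (C j))\<^sup>2 \<le> real m * A n" if n: "n \<in> {1..N}" for n j
  proof -
    have *: "norm (S n - z) \<le> norm (y - z)" "(dist y (S n))\<^sup>2 \<le> real (length (J n)) * A n"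
      "\<And>j. j \<in> set (J n) \<Longrightarrow> (infdist y (C j))\<^sup>2 \<le> real (length (J n)) * A n"
      using string_proj_decrease[of "J n" C z y, OF C[OF n]] unfolding S_def A_def by blast+
    show A0: "0 \<le> A n" using *(1) by (simp add: A_def power_mono)
    have "real (length (J n)) * A n \<le> real m * A n"
      using len[OF n] A0 by (intro mult_right_mono) auto
    then show "(norm (S n - y))\<^sup>2 \<le> real m * A n"
      "j \<in> set (J n) \<Longrightarrow> (infdist y (C j))\<^sup>2 \<le> real m * A n"
      using *(2,3) by (force simp: dist_norm norm_minus_commute)+
  qed
  have sum_A: "(\<Sum>n=1..N. w n * A n) \<le> ?A"
    using jensen[of z] w(3)
    by (simp add: A_def right_diff_distrib sum_subtractf flip: sum_distrib_right)
  have "0 \<le> (\<Sum>n=1..N. w n * A n)" by (intro sum_nonneg mult_nonneg_nonneg w0 A0) auto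
  with sum_A have "(norm (t - z))\<^sup>2 \<le> (norm (y - z))\<^sup>2" by linarith
  then show "norm (t - z) \<le> norm (y - z)" by (rule power2_le_imp_le) simp
  have "(dist y t)\<^sup>2 \<le> (\<Sum>n=1..N. w n * (norm (S n - y))\<^sup>2)"
    using jensen[of y] by (simp add: dist_norm norm_minus_commute)
  also have "\<dots> \<le> (\<Sum>n=1..N. w n * (real m * A n))"
    by (intro sum_mono mult_left_mono w0 step) auto
  also have "\<dots> = real m * (\<Sum>n=1..N. w n * A n)"
    by (simp add: sum_distrib_left algebra_simps)
  also have "\<dots> \<le> real m * ?A" using sum_A by (intro mult_left_mono) auto
  finally show "(dist y t)\<^sup>2 \<le> real m * ?A" .
  assume n: "n \<in> {1..N}" and j: "j \<in> set (J n)"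
  have "\<omega> * A n \<le> w n * A n" using w(1) n A0 by (intro mult_right_mono) auto
  also have "\<dots> \<le> (\<Sum>n=1..N. w n * A n)"
    using w0 A0 by (intro member_le_sum[OF n]) auto
  finally have "A n \<le> ?A / \<omega>" using sum_A w(2) by (simp add: field_simps)
  then have "real m * A n \<le> real m * (?A / \<omega>)" by (intro mult_left_mono) auto
  with reach[OF n j] show "(infdist y (C j))\<^sup>2 \<le> real m / \<omega> * ?A" by simp
qed

text \<open>For string averaging, \<open>c\<close> is a bound on the string lengths divided by a lower bound on the weights, and \<open>S\<close> is
  one of the sets projected onto in the step from \<open>x (k + l)\<close> to its successor.\<close>

lemma infdist_window_le:
  fixes x :: "nat \<Rightarrow> 'a::real_normed_vector"
  assumes mono: "decseq (\<lambda>k. norm (x k - z))" and c: "0 \<le> c"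
    and step: "\<And>k. (dist (x k) (x (Suc k)))\<^sup>2 \<le> c * ((norm (x k - z))\<^sup>2 - (norm (x (Suc k) - z))\<^sup>2)"
    and reach: "(infdist (x (k + l)) S)\<^sup>2
      \<le> c * ((norm (x (k + l) - z))\<^sup>2 - (norm (x (Suc (k + l)) - z))\<^sup>2)"
  shows "(infdist (x k) S)\<^sup>2 \<le> real (Suc l) * (c * ((norm (x k - z))\<^sup>2 - (norm (x (Suc (k + l)) - z))\<^sup>2))"
  using reach
proof (induction l arbitrary: k)
  case 0
  then show ?case by simp
next
  case (Suc l)
  let ?A = "c * ((norm (x k - z))\<^sup>2 - (norm (x (Suc k) - z))\<^sup>2)"
  let ?B = "c * ((norm (x (Suc k) - z))\<^sup>2 - (norm (x (Suc (Suc k + l)) - z))\<^sup>2)"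
  have "0 \<le> ?B"
    using decseqD[OF mono, of "Suc k" "Suc (Suc k + l)"] c
    by (intro mult_nonneg_nonneg) (auto simp: power_mono)
  moreover have "(infdist (x (Suc k)) S)\<^sup>2 \<le> real (Suc l) * ?B"
    using Suc.prems by (intro Suc.IH) simp
  ultimately have "(dist (x k) (x (Suc k)) + infdist (x (Suc k)) S)\<^sup>2 \<le> real (Suc (Suc l)) * (?A + ?B)"
    using step by (intro square_sum_le_Suc_mult)
  moreover have "(infdist (x k) S)\<^sup>2 \<le> (dist (x k) (x (Suc k)) + infdist (x (Suc k)) S)\<^sup>2"
    using infdist_triangle[of "x k" S "x (Suc k)"] by (intro power_mono) (auto simp: infdist_nonneg)
  ultimately show ?case by (simp add: algebra_simps)
qed

text \<open>Since \<open>E\<close> contracts only over \<open>s\<close> steps at once, up to \<open>s - 1\<close> factors \<open>q\<close> are lost.\<close>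

lemma geometric_decay_of_window:
  fixes E :: "nat \<Rightarrow> real"
  assumes "decseq E" "0 \<le> E 0" "0 < q" "q \<le> 1" "1 \<le> s" and step: "\<And>k. E (k + s) \<le> q ^ s * E k"
  shows "E k \<le> E 0 / q ^ (s - 1) * q ^ k"
proof (induction k rule: less_induct)
  case (less k)
  show ?case
  proof (cases "k < s")
    case True
    then have "q ^ (s - 1) \<le> q ^ k" using assms by (intro power_decreasing) auto
    then have "1 \<le> q ^ k / q ^ (s - 1)" using assms(3) by simp
    from mult_left_mono[OF this assms(2)] have "E 0 \<le> E 0 / q ^ (s - 1) * q ^ k" by simp
    with decseqD[OF assms(1), of 0 k] show ?thesis by simp
  next
    case False
    then have k: "k - s + s = k" "k - s < k" using assms(5) by auto
    have "E k \<le> q ^ s * E (k - s)" using step[of "k - s"] k by simp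
    also have "\<dots> \<le> q ^ s * (E 0 / q ^ (s - 1) * q ^ (k - s))"
      using assms(3) by (intro mult_left_mono less.IH k) auto
    also have "\<dots> = E 0 / q ^ (s - 1) * q ^ (k - s + s)" by (simp add: power_add)
    finally show ?thesis by (simp only: k)
  qed
qed

section \<open>Convergence of dynamic string averaging\<close>

theorem theorem9:
  fixes C :: "nat \<Rightarrow> 'a::{real_inner, complete_space} set"
    and D :: "'a set"
    and I :: "nat set"
    and M s m :: nat
    and N :: "nat \<Rightarrow> nat"
    and w :: "nat \<Rightarrow> nat \<Rightarrow> real"
    and J :: "nat \<Rightarrow> nat \<Rightarrow> nat list"
    and \<omega> r :: real
    and x :: "nat \<Rightarrow> 'a"
  assumes "1 \<le> M"
    and I: "I = {1..M}"
    and "\<And>i. i \<in> I \<Longrightarrow> closed (C i) \<and> convex (C i)"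
    and D: "D = (\<Inter>i\<in>I. C i)"
    and "D \<noteq> {}"
    and "\<And>k n. n \<in> {1..N k} \<Longrightarrow> set (J k n) \<subseteq> I"
    and "\<And>k n. n \<in> {1..N k} \<Longrightarrow> 0 < w k n \<and> w k n < 1"
    and "\<And>k. (\<Sum>n=1..N k. w k n) = 1"
    and "\<And>k. x (Suc k) = string_averaging C (N k) (w k) (J k) (x k)"
    and "0 < \<omega>"
    and "\<And>k n. n \<in> {1..N k} \<Longrightarrow> \<omega> \<le> w k n"
    and "bdd_above (range (\<lambda>k. MAX n\<in>{1..N k}. length (J k n)))"
    and m: "m = (SUP k. MAX n\<in>{1..N k}. length (J k n))"
    and "1 \<le> s"
    and "\<And>k. I = (\<Union>l\<in>{k..k + s - 1}. \<Union>n\<in>{1..N l}. set (J l n))"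
    and r: "r = infdist (x 0) D"
  shows "\<exists>xinf \<in> D \<inter> cball (metric_proj D (x 0)) r.
      weakly_converges_to x xinf \<and>
      (regular_over I C (cball (metric_proj D (x 0)) r) \<longrightarrow> x \<longlonglongrightarrow> xinf) \<and>
      (\<forall>\<kappa>. linearly_regular_over \<kappa> I C (cball (metric_proj D (x 0)) r) \<longrightarrow>
        (let q = (1 - \<omega> / (2 * real m * real s * \<kappa>\<^sup>2)) powr (1 / (2 * real s));
             c = 2 * infdist (x 0) D / q ^ (s - 1)
         in 0 < q \<and> q < 1 \<and>
            (\<forall>k. norm (x k - xinf) \<le> c * q ^ k) \<and>
            (\<forall>k. 1 / (2 * \<kappa>) * norm (x k - xinf) \<le> (MAX i\<in>I. infdist (x k) (C i)) \<and>
                 (MAX i\<in>I. infdist (x k) (C i)) \<le> c * q ^ k)))"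
proof -
  define d where "d k i = infdist (x k) (C i)" for k i
  define mx where "mx k = (MAX i\<in>I. infdist (x k) (C i))" for k
  define E where "E k = infdist (x k) D" for k
  have I_fin: "finite I" "I \<noteq> {}" using \<open>1 \<le> M\<close> I by auto
  have C: "closed (C i)" "convex (C i)" if "i \<in> I" for i using assms(3)[OF that] by auto
  have D_props: "closed D" "convex D" unfolding D using C by (auto intro: convex_INT)
  note D_ne = \<open>D \<noteq> {}\<close>
  have d_le_mx: "d k i \<le> mx k" if "i \<in> I" for k i
    using that I_fin by (auto simp: d_def mx_def)
  obtain j where j: "\<And>k. j k \<in> I" "\<And>k. mx k = d k (j k)"
  proof -
    have "mx k \<in> d k ` I" for k unfolding mx_def d_def using I_fin by (intro Max_in) auto
    then have "\<forall>k. \<exists>i\<in>I. mx k = d k i" by auto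
    then show thesis using that by metis
  qed
  have mx_nonneg: "0 \<le> mx k" for k using j(2) by (simp add: d_def infdist_nonneg)

  \<comment> \<open>The empty sum is not 1, so every step averages over at least one string.\<close>
  have N_pos: "{1..N k} \<noteq> {}" for k using assms(8)[of k] by (metis sum.empty zero_neq_one)
  have len: "length (J k n) \<le> m" if "n \<in> {1..N k}" for k n
  proof -
    have "length (J k n) \<le> (MAX n\<in>{1..N k}. length (J k n))" using that by (intro Max_ge) auto
    also have "\<dots> \<le> m" unfolding m by (intro cSUP_upper assms(12)) auto
    finally show ?thesis .
  qed
  have \<omega>: "0 < \<omega>" "\<omega> < 1"
  proof -
    obtain n where "n \<in> {1..N 0}" using N_pos[of 0] by blast
    then show "\<omega> < 1" using assms(7,11) by (meson order.strict_trans1)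
  qed (rule assms(10))
  have cover: "\<exists>l<s. \<exists>n\<in>{1..N (k + l)}. i \<in> set (J (k + l) n)" if i: "i \<in> I" for i k
  proof -
    obtain l n where "l \<in> {k..k + s - 1}" "n \<in> {1..N l}" "i \<in> set (J l n)"
      using i unfolding assms(15)[of k] by blast
    then show ?thesis using \<open>1 \<le> s\<close> by (intro exI[of _ "l - k"] conjI bexI[of _ n]) auto
  qed
  have m_pos: "1 \<le> m"
  proof -
    obtain i where "i \<in> I" using I_fin by auto
    then obtain l n where "n \<in> {1..N (0 + l)}" "i \<in> set (J (0 + l) n)" using cover by metis
    then show ?thesis using len[of n l] by (cases "J l n") auto
  qed

  let ?c = "real m / \<omega>"
  let ?dec = "\<lambda>z k. (norm (x k - z))\<^sup>2 - (norm (x (Suc k) - z))\<^sup>2"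
  have step: "norm (x (Suc k) - z) \<le> norm (x k - z)"
      "(dist (x k) (x (Suc k)))\<^sup>2 \<le> ?c * ?dec z k"
    and reach: "n \<in> {1..N k} \<Longrightarrow> i \<in> set (J k n) \<Longrightarrow> (d k i)\<^sup>2 \<le> ?c * ?dec z k"
    if z: "z \<in> D" for z k n i
  proof -
    have Cz: "closed (C i) \<and> convex (C i) \<and> z \<in> C i" if "n \<in> {1..N k}" "i \<in> set (J k n)" for n i
      using that z assms(6)[of n k] C D by auto
    note average = string_averaging_decrease[where C = C and N = "N k" and J = "J k" and w = "w k"
        and y = "x k" and z = z and m = m and \<omega> = \<omega>, folded assms(9)]
    show mono: "norm (x (Suc k) - z) \<le> norm (x k - z)"
      by (rule average(1)) (fact Cz assms(11) \<omega>(1) assms(8) len)+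
    show "(d k i)\<^sup>2 \<le> ?c * ?dec z k" if "n \<in> {1..N k}" "i \<in> set (J k n)"
      unfolding d_def by (rule average(3)) (fact Cz assms(11) \<omega>(1) assms(8) len that)+
    have displacement: "(dist (x k) (x (Suc k)))\<^sup>2 \<le> real m * ?dec z k"
      by (rule average(2)) (fact Cz assms(11) \<omega>(1) assms(8) len)+
    \<comment> \<open>Both estimates may share the constant \<open>m / \<omega>\<close>, because the weights are less than 1.\<close>
    have "real m \<le> ?c" using \<omega> by (simp add: pos_le_divide_eq mult_left_le)
    moreover have "0 \<le> ?dec z k" using mono by (simp add: power_mono)
    ultimately have "real m * ?dec z k \<le> ?c * ?dec z k" by (rule mult_right_mono)
    with displacement show "(dist (x k) (x (Suc k)))\<^sup>2 \<le> ?c * ?dec z k" by (rule order_trans)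
  qed
  have fejer: "fejer_monotone D x"
    unfolding fejer_monotone_def by (intro ballI decseq_SucI step(1))
  have mono: "norm (x l - z) \<le> norm (x k - z)" if "z \<in> D" "k \<le> l" for z k l
    using fejer that decseqD[of "\<lambda>k. norm (x k - z)" k l] by (simp add: fejer_monotone_def)

  \<comment> \<open>The set \<open>C i\<close> is visited at some step \<open>k + l\<close> with \<open>l < s\<close>; the bound over these \<open>l + 1\<close> steps
    only grows when the window is extended to \<open>s\<close> steps.\<close>
  have d_window: "(d k i)\<^sup>2 \<le> real s * (?c * ((norm (x k - z))\<^sup>2 - (norm (x (k + s) - z))\<^sup>2))"
    if z: "z \<in> D" and i: "i \<in> I" for z k i
  proof -
    obtain l n where l: "l < s" and n: "n \<in> {1..N (k + l)}" "i \<in> set (J (k + l) n)"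
      using cover[OF i] by blast
    have "(d k i)\<^sup>2 \<le> real (Suc l) * (?c * ((norm (x k - z))\<^sup>2 - (norm (x (Suc (k + l)) - z))\<^sup>2))"
      unfolding d_def using fejer z \<omega> step(2)[OF z] reach[OF z n]
      by (intro infdist_window_le) (auto simp: fejer_monotone_def d_def)
    also have "\<dots> \<le> real s * (?c * ((norm (x k - z))\<^sup>2 - (norm (x (k + s) - z))\<^sup>2))"
      using l \<omega> mono[OF z]
      by (intro mult_mono mult_left_mono diff_left_mono power_mono mult_nonneg_nonneg)
        (auto simp: power_mono)
    finally show ?thesis .
  qed
  have mx_window: "(mx k)\<^sup>2 \<le> real s * (?c * ((norm (x k - z))\<^sup>2 - (norm (x (k + s) - z))\<^sup>2))"
    if "z \<in> D" for z k
    unfolding j(2) by (rule d_window[OF that j(1)])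

  have mx_lim: "mx \<longlonglongrightarrow> 0"
  proof -
    obtain z where z: "z \<in> D" using D_ne by auto
    obtain L where L: "(\<lambda>k. norm (x k - z)) \<longlonglongrightarrow> L"
      using fejer_monotone_norm_convergent[OF fejer z] .
    have "(\<lambda>k. real s * (?c * ((norm (x k - z))\<^sup>2 - (norm (x (k + s) - z))\<^sup>2)))
        \<longlonglongrightarrow> real s * (?c * (L\<^sup>2 - L\<^sup>2))"
      by (intro tendsto_intros L LIMSEQ_ignore_initial_segment[OF L])
    then have bound_lim:
      "(\<lambda>k. real s * (?c * ((norm (x k - z))\<^sup>2 - (norm (x (k + s) - z))\<^sup>2))) \<longlonglongrightarrow> 0"
      by simp
    have "(\<lambda>k. (mx k)\<^sup>2) \<longlonglongrightarrow> 0"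
      by (rule tendsto_sandwich[OF _ _ tendsto_const bound_lim])
        (intro always_eventually allI zero_le_power2 mx_window[OF z])+
    then have "(\<lambda>k. sqrt ((mx k)\<^sup>2)) \<longlonglongrightarrow> sqrt 0" by (rule tendsto_real_sqrt)
    then show ?thesis using mx_nonneg by simp
  qed
  have d_lim: "(\<lambda>k. infdist (x k) (C i)) \<longlonglongrightarrow> 0" if "i \<in> I" for i
    by (rule tendsto_sandwich[OF _ _ tendsto_const mx_lim])
      (intro always_eventually allI infdist_nonneg d_le_mx[OF that, unfolded d_def])+

  obtain l where l: "l \<in> D" "weakly_converges_to x l"
    using fejer_monotone_weakly_convergent[of I C x] assms(3) D_ne fejer d_lim unfolding D by blast
  note limit = fejer_monotone_weak_limit[OF D_props D_ne fejer l(2)]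
  let ?p = "metric_proj D (x 0)"
  have p: "?p \<in> D" "norm (x 0 - ?p) = r"
    using metric_proj_in[OF D_props D_ne] dist_metric_proj[OF D_props D_ne, of "x 0"] r
    by (auto simp: dist_norm)
  have in_ball: "x k \<in> cball ?p r" for k
    using mono[OF p(1), of 0 k] p(2) by (simp add: dist_norm norm_minus_commute)
  have l_in: "l \<in> D \<inter> cball ?p r" using l(1) limit(1)[of 0] r by simp

  have norm_conv: "x \<longlonglongrightarrow> l" if "regular_over I C (cball ?p r)"
  proof -
    have "E \<longlonglongrightarrow> 0"
      using that in_ball mx_lim unfolding regular_over_def E_def[abs_def] D mx_def[abs_def] by blast
    then have bound_lim: "(\<lambda>k. 2 * E k) \<longlonglongrightarrow> 0" by (rule tendsto_mult_right_zero)
    have "(\<lambda>k. norm (x k - l)) \<longlonglongrightarrow> 0"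
      by (rule tendsto_sandwich[OF _ _ tendsto_const bound_lim])
        (intro always_eventually allI norm_ge_zero limit(2)[folded E_def])+
    then show ?thesis by (rule LIM_zero_cancel[OF tendsto_norm_zero_cancel])
  qed

  have linear: "let q = (1 - \<omega> / (2 * real m * real s * \<kappa>\<^sup>2)) powr (1 / (2 * real s));
             c = 2 * infdist (x 0) D / q ^ (s - 1)
         in 0 < q \<and> q < 1 \<and>
            (\<forall>k. norm (x k - l) \<le> c * q ^ k) \<and>
            (\<forall>k. 1 / (2 * \<kappa>) * norm (x k - l) \<le> (MAX i\<in>I. infdist (x k) (C i)) \<and>
                 (MAX i\<in>I. infdist (x k) (C i)) \<le> c * q ^ k)"
    if lin: "linearly_regular_over \<kappa> I C (cball ?p r)" for \<kappa>
  proof -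
    have \<kappa>: "1 \<le> \<kappa>" and E_le: "E k \<le> \<kappa> * mx k" for k
      using lin in_ball[of k] by (auto simp: linearly_regular_over_def E_def mx_def D)
    have E_nonneg: "0 \<le> E k" for k by (simp add: E_def infdist_nonneg)
    define K where "K = real m * real s * \<kappa>\<^sup>2"
    define b where "b = 1 - \<omega> / (2 * K)"
    define q where "q = b powr (1 / (2 * real s))"
    have "1 * 1 * 1 \<le> K" unfolding K_def
      using m_pos \<open>1 \<le> s\<close> \<kappa> by (intro mult_mono) auto
    then have K: "1 \<le> K" by simp
    then have b: "0 < b" "b < 1" using \<omega> by (auto simp: b_def field_simps)
    have q: "0 < q" "q < 1"
      using b \<open>1 \<le> s\<close> powr_less_mono2[of "1 / (2 * real s)" b 1] by (auto simp: q_def)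
    have "q ^ (2 * s) = b"
      using b \<open>1 \<le> s\<close> by (simp add: q_def powr_powr flip: powr_realpow)
    then have q_pow: "(q ^ s)\<^sup>2 = b" by (simp add: power_mult mult.commute flip: power_mult)

    have "decseq E"
    proof (rule decseq_SucI)
      fix k
      have "E (Suc k) \<le> dist (x (Suc k)) (metric_proj D (x k))"
        unfolding E_def by (intro infdist_le metric_proj_in D_props D_ne)
      also have "\<dots> \<le> dist (x k) (metric_proj D (x k))"
        using step(1)[OF metric_proj_in[OF D_props D_ne]] by (simp add: dist_norm)
      finally show "E (Suc k) \<le> E k" by (simp add: E_def dist_metric_proj[OF D_props D_ne])
    qed
    \<comment> \<open>In terms of squares the factor is \<open>b = 1 - \<omega> / (2 * K)\<close>. The window estimate at the projection
      of \<open>x k\<close> gives the smaller factor \<open>1 - \<omega> / K\<close>.\<close>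
    have contraction: "E (k + s) \<le> q ^ s * E k" for k
    proof -
      let ?z = "metric_proj D (x k)"
      have z: "?z \<in> D" "norm (x k - ?z) = E k"
        using metric_proj_in[OF D_props D_ne] dist_metric_proj[OF D_props D_ne, of "x k"]
        by (auto simp: dist_norm E_def)
      have E_next: "(E (k + s))\<^sup>2 \<le> (norm (x (k + s) - ?z))\<^sup>2"
        using infdist_le[OF z(1), of "x (k + s)"] E_nonneg
        by (intro power_mono) (auto simp: E_def dist_norm)
      have "(E k)\<^sup>2 \<le> (\<kappa> * mx k)\<^sup>2" using E_le E_nonneg by (rule power_mono)
      also have "\<dots> \<le> \<kappa>\<^sup>2 * (real s * (?c * ((norm (x k - ?z))\<^sup>2 - (norm (x (k + s) - ?z))\<^sup>2)))"
        unfolding power_mult_distrib by (intro mult_left_mono mx_window z(1)) auto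
      also have "\<dots> = K / \<omega> * ((E k)\<^sup>2 - (norm (x (k + s) - ?z))\<^sup>2)"
        by (simp add: K_def z(2))
      also have "\<dots> \<le> K / \<omega> * ((E k)\<^sup>2 - (E (k + s))\<^sup>2)"
        using E_next K \<omega> by (intro mult_left_mono) auto
      finally have "(E (k + s))\<^sup>2 \<le> (1 - \<omega> / K) * (E k)\<^sup>2"
        using K \<omega> by (simp add: field_simps)
      also have "\<dots> \<le> b * (E k)\<^sup>2"
        using K \<omega> by (intro mult_right_mono) (auto simp: b_def field_simps)
      finally have "(E (k + s))\<^sup>2 \<le> (q ^ s * E k)\<^sup>2" by (simp add: power_mult_distrib q_pow)
      then show ?thesis by (rule power2_le_imp_le) (use q E_nonneg in auto)
    qed
    let ?C = "2 * E 0 / q ^ (s - 1)"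
    have rate: "2 * E k \<le> ?C * q ^ k" for k
      using geometric_decay_of_window[OF \<open>decseq E\<close> E_nonneg q(1) _ \<open>1 \<le> s\<close> contraction, of k] q
      by simp
    have "norm (x k - l) \<le> ?C * q ^ k" for k
      using limit(2)[of k] rate[of k] by (simp add: E_def)
    moreover have "1 / (2 * \<kappa>) * norm (x k - l) \<le> mx k" for k
      using limit(2)[of k] E_le[of k] \<kappa> by (simp add: E_def field_simps)
    moreover have "mx k \<le> ?C * q ^ k" for k
    proof -
      have "mx k \<le> E k"
        unfolding j(2) d_def E_def using j(1) D D_ne by (intro infdist_mono) auto
      with E_nonneg[of k] rate[of k] show ?thesis by linarith
    qed
    ultimately show ?thesis
      using q unfolding Let_def mx_def E_def q_def b_def K_def by (simp add: mult.assoc)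
  qed
  show ?thesis
    by (rule bexI[OF _ l_in]) (use l(2) norm_conv linear in blast)
qed

end
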